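(* Let $S$ be an (additively written) abelian group. Then $S$ acts on the Lie algebra $\mathfrak{g}_S$ as an automorphism group with $\gamma\cdot d^{\alpha,\beta}=d^{\alpha,\beta+\gamma}$ for $\gamma,\alpha,\beta\in S$.
   Context: $\mathfrak{g}_S$ is the complex Lie algebra with generators $d^{\alpha,\beta}$ ($\alpha,\beta\in S$), subject to $d^{-\alpha,\beta}=-d^{\alpha,\beta}$ and $$[d^{\alpha,\beta},d^{\mu,\nu}]=\delta_{\alpha+\mu,\nu-\beta}d^{\alpha+\mu,-\alpha+\nu}-\delta_{\alpha+\mu,\beta-\nu}d^{\alpha+\mu,\alpha+\nu}-\delta_{\alpha-\mu,\nu-\beta}d^{\alpha-\mu,\nu-\alpha}+\delta_{\alpha-\mu,\beta-\nu}d^{\alpha-\mu,\alpha+\nu}$$ for $\alpha,\beta,\mu,\nu\in S$. "Acts as an automorphism group" means that $S$ acts by Lie algebra automorphisms. *)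

theory Defs
  imports Complex_Main
begin

locale lie_algebra = vector_space scale
  for scale :: "'k::field \<Rightarrow> 'v::ab_group_add \<Rightarrow> 'v" +
  fixes bracket :: "'v \<Rightarrow> 'v \<Rightarrow> 'v"
  assumes bracket_add_left: "bracket (x + y) z = bracket x z + bracket y z"
    and bracket_add_right: "bracket x (y + z) = bracket x y + bracket x z"
    and bracket_scale_left: "bracket (scale c x) y = scale c (bracket x y)"
    and bracket_scale_right: "bracket x (scale c y) = scale c (bracket x y)"
    and bracket_self: "bracket x x = 0"
    and jacobi: "bracket x (bracket y z) + bracket y (bracket z x) + bracket z (bracket x y) = 0"

locale lie_hom =
  dom: lie_algebra scale1 bracket1 + cod: lie_algebra scale2 bracket2
  for scale1 :: "'k::field \<Rightarrow> 'v::ab_group_add \<Rightarrow> 'v" and bracket1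
    and scale2 :: "'k::field \<Rightarrow> 'w::ab_group_add \<Rightarrow> 'w" and bracket2 +
  fixes f :: "'v \<Rightarrow> 'w"
  assumes linear: "Vector_Spaces.linear scale1 scale2 f"
    and bracket: "f (bracket1 x y) = bracket2 (f x) (f y)"

locale lie_automorphism = lie_hom scale bracket scale bracket f
  for scale :: "'k::field \<Rightarrow> 'v::ab_group_add \<Rightarrow> 'v" and bracket and f :: "'v \<Rightarrow> 'v" +
  assumes bij: "bij f"

locale lie_automorphism_action = lie_algebra scale bracket
  for scale :: "'k::field \<Rightarrow> 'v::ab_group_add \<Rightarrow> 'v" and bracket +
  fixes act :: "'s::ab_group_add \<Rightarrow> 'v \<Rightarrow> 'v"
  assumes automorphism: "lie_automorphism scale bracket (act \<gamma>)"
    and act_zero: "act 0 x = x"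
    and act_add: "act (\<gamma> + \<delta>) x = act \<gamma> (act \<delta> x)"

datatype 'g lie_expr =
    Gen 'g
  | Zero
  | Plus "'g lie_expr" "'g lie_expr"
  | Neg "'g lie_expr"
  | Scale complex "'g lie_expr"
  | Bracket "'g lie_expr" "'g lie_expr"

text \<open>
  The least congruence containing the relations \<open>R\<close> and all instances of the axioms of a
  complex Lie algebra. The quotient by it is the Lie algebra presented by the generators
  \<open>'g\<close> and the relations \<open>R\<close>.
\<close>

inductive lie_cong ::
    "('g lie_expr \<times> 'g lie_expr) set \<Rightarrow> 'g lie_expr \<Rightarrow> 'g lie_expr \<Rightarrow> bool"
  for R where
  rel: "(x, y) \<in> R \<Longrightarrow> lie_cong R x y"
| refl: "lie_cong R x x"
| sym: "lie_cong R x y \<Longrightarrow> lie_cong R y x"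
| trans: "lie_cong R x y \<Longrightarrow> lie_cong R y z \<Longrightarrow> lie_cong R x z"
| plus_cong: "lie_cong R x x' \<Longrightarrow> lie_cong R y y' \<Longrightarrow> lie_cong R (Plus x y) (Plus x' y')"
| neg_cong: "lie_cong R x x' \<Longrightarrow> lie_cong R (Neg x) (Neg x')"
| scale_cong: "lie_cong R x x' \<Longrightarrow> lie_cong R (Scale c x) (Scale c x')"
| bracket_cong: "lie_cong R x x' \<Longrightarrow> lie_cong R y y' \<Longrightarrow> lie_cong R (Bracket x y) (Bracket x' y')"
| plus_assoc: "lie_cong R (Plus (Plus x y) z) (Plus x (Plus y z))"
| plus_commute: "lie_cong R (Plus x y) (Plus y x)"
| plus_zero: "lie_cong R (Plus Zero x) x"
| plus_neg: "lie_cong R (Plus (Neg x) x) Zero"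
| scale_plus: "lie_cong R (Scale c (Plus x y)) (Plus (Scale c x) (Scale c y))"
| scale_add: "lie_cong R (Scale (c + d) x) (Plus (Scale c x) (Scale d x))"
| scale_scale: "lie_cong R (Scale c (Scale d x)) (Scale (c * d) x)"
| scale_one: "lie_cong R (Scale 1 x) x"
| bracket_plus_left: "lie_cong R (Bracket (Plus x y) z) (Plus (Bracket x z) (Bracket y z))"
| bracket_plus_right: "lie_cong R (Bracket x (Plus y z)) (Plus (Bracket x y) (Bracket x z))"
| bracket_scale_left: "lie_cong R (Bracket (Scale c x) y) (Scale c (Bracket x y))"
| bracket_scale_right: "lie_cong R (Bracket x (Scale c y)) (Scale c (Bracket x y))"
| bracket_self: "lie_cong R (Bracket x x) Zero"
| jacobi: "lie_cong R
    (Plus (Plus (Bracket x (Bracket y z)) (Bracket y (Bracket z x))) (Bracket z (Bracket x y))) Zero"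

lemma equivp_lie_cong: "equivp (lie_cong R)"
  by (rule equivpI) (auto intro!: reflpI sympI transpI intro: lie_cong.refl lie_cong.sym lie_cong.trans)

text \<open>The generator \<open>d\<^sup>\<alpha>\<^sup>,\<^sup>\<beta>\<close> is indexed by the pair \<open>(\<alpha>, \<beta>)\<close>, and \<open>of_bool (a = b)\<close> is the Kronecker delta.\<close>

definition gS_relations ::
    "(('s::ab_group_add \<times> 's) lie_expr \<times> ('s \<times> 's) lie_expr) set" where
  "gS_relations =
     {(Gen (- \<alpha>, \<beta>), Neg (Gen (\<alpha>, \<beta>))) | \<alpha> \<beta>. True} \<union>
     {(Bracket (Gen (\<alpha>, \<beta>)) (Gen (\<mu>, \<nu>)),
       Plus (Plus (Plus
         (Scale (of_bool (\<alpha> + \<mu> = \<nu> - \<beta>)) (Gen (\<alpha> + \<mu>, - \<alpha> + \<nu>)))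
         (Neg (Scale (of_bool (\<alpha> + \<mu> = \<beta> - \<nu>)) (Gen (\<alpha> + \<mu>, \<alpha> + \<nu>)))))
         (Neg (Scale (of_bool (\<alpha> - \<mu> = \<nu> - \<beta>)) (Gen (\<alpha> - \<mu>, \<nu> - \<alpha>)))))
         (Scale (of_bool (\<alpha> - \<mu> = \<beta> - \<nu>)) (Gen (\<alpha> - \<mu>, \<alpha> + \<nu>)))) | \<alpha> \<beta> \<mu> \<nu>. True}"

quotient_type (overloaded) 's gS =
  "('s::ab_group_add \<times> 's) lie_expr" / "lie_cong gS_relations"
  by (rule equivp_lie_cong)

instantiation gS :: (ab_group_add) ab_group_add
begin

lift_definition zero_gS :: "'a gS" is Zero .
lift_definition plus_gS :: "'a gS \<Rightarrow> 'a gS \<Rightarrow> 'a gS" is Plus by (rule lie_cong.plus_cong)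
lift_definition uminus_gS :: "'a gS \<Rightarrow> 'a gS" is Neg by (rule lie_cong.neg_cong)
definition minus_gS :: "'a gS \<Rightarrow> 'a gS \<Rightarrow> 'a gS" where "minus_gS x y = x + - y"

instance
  by standard (unfold minus_gS_def, (transfer, blast intro: lie_cong.intros)+)

end

lift_definition gS_scale :: "complex \<Rightarrow> 's::ab_group_add gS \<Rightarrow> 's gS" is Scale
  by (rule lie_cong.scale_cong)

lift_definition gS_bracket :: "'s::ab_group_add gS \<Rightarrow> 's gS \<Rightarrow> 's gS" is Bracket
  by (rule lie_cong.bracket_cong)

lift_definition gS_gen :: "'s::ab_group_add \<Rightarrow> 's \<Rightarrow> 's gS" is "\<lambda>\<alpha> \<beta>. Gen (\<alpha>, \<beta>)" .

lemma lie_algebra_gS: "lie_algebra gS_scale gS_bracket"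
  by unfold_locales (transfer, blast intro: lie_cong.intros)+

lemma gS_gen_uminus: "gS_gen (- \<alpha>) \<beta> = - gS_gen \<alpha> \<beta>"
  by transfer (rule lie_cong.rel, auto simp: gS_relations_def)

lemma gS_bracket_gen:
  "gS_bracket (gS_gen \<alpha> \<beta>) (gS_gen \<mu> \<nu>) =
     gS_scale (of_bool (\<alpha> + \<mu> = \<nu> - \<beta>)) (gS_gen (\<alpha> + \<mu>) (- \<alpha> + \<nu>))
   - gS_scale (of_bool (\<alpha> + \<mu> = \<beta> - \<nu>)) (gS_gen (\<alpha> + \<mu>) (\<alpha> + \<nu>))
   - gS_scale (of_bool (\<alpha> - \<mu> = \<nu> - \<beta>)) (gS_gen (\<alpha> - \<mu>) (\<nu> - \<alpha>))
   + gS_scale (of_bool (\<alpha> - \<mu> = \<beta> - \<nu>)) (gS_gen (\<alpha> - \<mu>) (\<alpha> + \<nu>))"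
  unfolding minus_gS_def
  by transfer (rule lie_cong.rel, unfold gS_relations_def, blast)

primrec lie_eval ::
    "(complex \<Rightarrow> 'v::ab_group_add \<Rightarrow> 'v) \<Rightarrow> ('v \<Rightarrow> 'v \<Rightarrow> 'v) \<Rightarrow> ('g \<Rightarrow> 'v) \<Rightarrow> 'g lie_expr \<Rightarrow> 'v" where
  "lie_eval s b g (Gen i) = g i"
| "lie_eval s b g Zero = 0"
| "lie_eval s b g (Plus x y) = lie_eval s b g x + lie_eval s b g y"
| "lie_eval s b g (Neg x) = - lie_eval s b g x"
| "lie_eval s b g (Scale c x) = s c (lie_eval s b g x)"
| "lie_eval s b g (Bracket x y) = b (lie_eval s b g x) (lie_eval s b g y)"

lemma lie_eval_cong:
  assumes "lie_algebra s b"
    and "\<And>x y. (x, y) \<in> R \<Longrightarrow> lie_eval s b g x = lie_eval s b g y"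
    and "lie_cong R x y"
  shows "lie_eval s b g x = lie_eval s b g y"
proof -
  interpret lie_algebra s b by fact
  from assms(3) show ?thesis
    by induction
      (simp_all add: assms(2) ac_simps scale_right_distrib scale_left_distrib bracket_add_left
        bracket_add_right bracket_scale_left bracket_scale_right bracket_self jacobi[simplified ac_simps])
qed

text \<open>This characterises \<open>gS\<close> up to unique isomorphism, independently of the construction above.\<close>

lemma gS_universal:
  fixes scale :: "complex \<Rightarrow> 'v::ab_group_add \<Rightarrow> 'v"
    and d :: "'s::ab_group_add \<Rightarrow> 's \<Rightarrow> 'v"
  assumes "lie_algebra scale bracket"
    and "\<And>\<alpha> \<beta>. d (- \<alpha>) \<beta> = - d \<alpha> \<beta>"
    and "\<And>\<alpha> \<beta> \<mu> \<nu>. bracket (d \<alpha> \<beta>) (d \<mu> \<nu>) =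
        scale (of_bool (\<alpha> + \<mu> = \<nu> - \<beta>)) (d (\<alpha> + \<mu>) (- \<alpha> + \<nu>))
      - scale (of_bool (\<alpha> + \<mu> = \<beta> - \<nu>)) (d (\<alpha> + \<mu>) (\<alpha> + \<nu>))
      - scale (of_bool (\<alpha> - \<mu> = \<nu> - \<beta>)) (d (\<alpha> - \<mu>) (\<nu> - \<alpha>))
      + scale (of_bool (\<alpha> - \<mu> = \<beta> - \<nu>)) (d (\<alpha> - \<mu>) (\<alpha> + \<nu>))"
  shows "\<exists>!f. lie_hom gS_scale gS_bracket scale bracket f \<and> (\<forall>\<alpha> \<beta>. f (gS_gen \<alpha> \<beta>) = d \<alpha> \<beta>)"
proof -
  interpret cod: lie_algebra scale bracket by fact
  interpret dom: lie_algebra gS_scale "gS_bracket :: 's gS \<Rightarrow> _" by (rule lie_algebra_gS)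
  let ?e = "lie_eval scale bracket (\<lambda>(\<alpha>, \<beta>). d \<alpha> \<beta>)"
  have rel: "?e x = ?e y" if "(x, y) \<in> gS_relations" for x y
    using that unfolding gS_relations_def by (auto simp: assms(2,3))
  define f where "f x = ?e (rep_gS x)" for x :: "'s gS"
  have f_abs: "f (abs_gS x) = ?e x" for x
  proof -
    have "lie_cong gS_relations (rep_gS (abs_gS x)) x"
      by (meson Quotient3_gS rep_abs_rsp_left lie_cong.refl)
    then show ?thesis unfolding f_def by (rule lie_eval_cong[OF assms(1), rotated]) (rule rel)
  qed
  have add: "f (x + y) = f x + f y" for x y
    by (induction x rule: gS.abs_induct; induction y rule: gS.abs_induct) (simp add: plus_gS.abs_eq f_abs)
  have scl: "f (gS_scale c x) = scale c (f x)" for c x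
    by (induction x rule: gS.abs_induct) (simp add: gS_scale.abs_eq f_abs)
  have brk: "f (gS_bracket x y) = bracket (f x) (f y)" for x y
    by (induction x rule: gS.abs_induct; induction y rule: gS.abs_induct) (simp add: gS_bracket.abs_eq f_abs)
  have hom: "lie_hom gS_scale gS_bracket scale bracket f"
    by unfold_locales (simp_all add: add scl brk)
  have gen: "f (gS_gen \<alpha> \<beta>) = d \<alpha> \<beta>" for \<alpha> \<beta>
    by (simp add: gS_gen.abs_eq f_abs)
  have unique: "h = f"
    if h: "lie_hom gS_scale gS_bracket scale bracket h" and g: "\<forall>\<alpha> \<beta>. h (gS_gen \<alpha> \<beta>) = d \<alpha> \<beta>" for h
  proof
    interpret h: lie_hom gS_scale gS_bracket scale bracket h by fact
    interpret hl: Vector_Spaces.linear gS_scale scale h by (rule h.linear)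
    have "h (abs_gS x) = ?e x" for x
    proof (induction x)
      case (Gen i)
      then show ?case by (cases i) (simp add: gS_gen.abs_eq[symmetric] g)
    qed (simp_all add: zero_gS.abs_eq[symmetric] plus_gS.abs_eq[symmetric] uminus_gS.abs_eq[symmetric]
        gS_scale.abs_eq[symmetric] gS_bracket.abs_eq[symmetric] hl.zero hl.add hl.neg hl.scale h.bracket)
    then show "h x = f x" for x
      by (induction x rule: gS.abs_induct) (simp add: f_abs)
  qed
  show ?thesis using hom gen unique by blast
qed

end

theory Submission
  imports Defs
begin

text \<open>
  The indices \<open>\<beta>, \<nu>\<close> enter the Kronecker deltas of the bracket relation only through
  \<open>\<beta> - \<nu>\<close>, and every generator on the right has second index \<open>\<nu> \<plusminus> \<alpha>\<close>. The relations are
  therefore stable under the simultaneous translation of \<open>\<beta>\<close> and \<open>\<nu>\<close> by \<open>\<gamma>\<close>, and translation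
  of expressions descends to the quotient.
\<close>

text \<open>By induction on the derivation: the Lie algebra axioms are schematic in their
  subexpressions, so renaming generators sends instances to instances, and only \<open>rel\<close>
  needs the hypothesis.\<close>

lemma lie_cong_map:
  assumes "\<And>x y. (x, y) \<in> R \<Longrightarrow> lie_cong R' (map_lie_expr f x) (map_lie_expr f y)"
    and "lie_cong R x y"
  shows "lie_cong R' (map_lie_expr f x) (map_lie_expr f y)"
  using assms(2)
proof induction
  case (sym x y)
  then show ?case by (blast intro: lie_cong.sym)
next
  case (trans x y z)
  then show ?case by (blast intro: lie_cong.trans)
qed (simp_all add: assms(1) lie_cong.intros(2,5-))

lemma gS_relations_translate:
  assumes "(x, y) \<in> gS_relations"
  shows "(map_lie_expr (map_prod id (\<lambda>\<beta>. \<beta> + \<gamma>)) x, map_lie_expr (map_prod id (\<lambda>\<beta>. \<beta> + \<gamma>)) y)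
    \<in> gS_relations"
proof -
  consider (neg) \<alpha> \<beta> where "(x, y) = (Gen (- \<alpha>, \<beta>), Neg (Gen (\<alpha>, \<beta>)))"
    | (bracket) \<alpha> \<beta> \<mu> \<nu> where "(x, y) = (Bracket (Gen (\<alpha>, \<beta>)) (Gen (\<mu>, \<nu>)),
       Plus (Plus (Plus
         (Scale (of_bool (\<alpha> + \<mu> = \<nu> - \<beta>)) (Gen (\<alpha> + \<mu>, - \<alpha> + \<nu>)))
         (Neg (Scale (of_bool (\<alpha> + \<mu> = \<beta> - \<nu>)) (Gen (\<alpha> + \<mu>, \<alpha> + \<nu>)))))
         (Neg (Scale (of_bool (\<alpha> - \<mu> = \<nu> - \<beta>)) (Gen (\<alpha> - \<mu>, \<nu> - \<alpha>)))))
         (Scale (of_bool (\<alpha> - \<mu> = \<beta> - \<nu>)) (Gen (\<alpha> - \<mu>, \<alpha> + \<nu>))))"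
    using assms unfolding gS_relations_def by blast
  then show ?thesis
  proof cases
    case neg
    then show ?thesis unfolding gS_relations_def by auto
  next
    case bracket
    then show ?thesis unfolding gS_relations_def
      \<comment> \<open>The image is the relation at the shifted second indices:
        \<open>\<gamma>\<close> cancels in each delta and is carried along in each generator on the
        right.\<close>
      by (intro UnI2 CollectI exI[of _ \<alpha>] exI[of _ "\<beta> + \<gamma>"] exI[of _ \<mu>] exI[of _ "\<nu> + \<gamma>"])
        (simp add: algebra_simps)
  qed
qed

lift_definition gS_translate :: "'s::ab_group_add \<Rightarrow> 's gS \<Rightarrow> 's gS"
  is "\<lambda>\<gamma>. map_lie_expr (map_prod id (\<lambda>\<beta>. \<beta> + \<gamma>))"
  by (rule lie_cong_map[OF lie_cong.rel[OF gS_relations_translate]])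

lemma gS_translate_gen: "gS_translate \<gamma> (gS_gen \<alpha> \<beta>) = gS_gen \<alpha> (\<beta> + \<gamma>)"
  by transfer (simp add: lie_cong.refl)

lemma gS_translate_0: "gS_translate 0 x = x"
  by transfer (simp add: prod.map_id0 lie_expr.map_id lie_cong.refl flip: id_def)

text \<open>By functoriality of \<open>map_lie_expr\<close>, this reduces to \<open>\<beta> +
  (\<gamma> + \<delta>) = (\<beta> + \<delta>) + \<gamma>\<close>.\<close>

lemma gS_translate_add: "gS_translate (\<gamma> + \<delta>) x = gS_translate \<gamma> (gS_translate \<delta> x)"
  by transfer
    (simp add: lie_expr.map_comp prod.map_comp comp_def id_def ac_simps lie_cong.refl)

text \<open>\<open>map_lie_expr\<close> commutes with the constructors and fixes scalars, so on
  representatives both sides are the same expression.\<close>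

lemma lie_hom_gS_translate: "lie_hom gS_scale gS_bracket gS_scale gS_bracket (gS_translate \<gamma>)"
proof -
  interpret lie_algebra gS_scale "gS_bracket :: 'a gS \<Rightarrow> _" by (rule lie_algebra_gS)
  show ?thesis
    by unfold_locales (transfer, simp add: lie_cong.refl)+
qed

theorem lemma2p10:
  "\<exists>act :: 's::ab_group_add \<Rightarrow> 's gS \<Rightarrow> 's gS.
     lie_automorphism_action gS_scale gS_bracket act \<and>
     (\<forall>\<gamma> \<alpha> \<beta>. act \<gamma> (gS_gen \<alpha> \<beta>) = gS_gen \<alpha> (\<beta> + \<gamma>))"
proof (intro exI conjI allI)
  have "bij (gS_translate \<gamma>)" for \<gamma> :: 's
    \<comment> \<open>Both composites with translation by \<open>- \<gamma>\<close> are translation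
      by \<open>0\<close>.\<close>
    by (rule bij_betw_byWitness[where f' = "gS_translate (- \<gamma>)"])
      (simp_all add: gS_translate_0 flip: gS_translate_add)
  then show "lie_automorphism_action gS_scale gS_bracket (gS_translate :: 's \<Rightarrow> _)"
    by (intro lie_automorphism_action.intro lie_automorphism_action_axioms.intro
        lie_automorphism.intro lie_automorphism_axioms.intro
        lie_algebra_gS lie_hom_gS_translate gS_translate_0 gS_translate_add)
qed (rule gS_translate_gen)

end
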